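(* There are a picoscopic set $X\subseteq\mathbb{R}$ and a point $x\in\mathbb{R}$ such that $X\cup\{x\}$ is not picoscopic.
   Context: $\omega=\{0,1,2,\ldots\}$; $|J|$ denotes the length of an interval $J\subseteq\mathbb{R}$. A set $M\subseteq\mathbb{R}$ is called picoscopic if for every $\varepsilon\in(0,1)$ there is a sequence of intervals $(I_k)_{k\in\omega}$ such that $M\subseteq\bigcup_k I_k$ and $|I_k|\le\varepsilon^{(k+1)!}$ for all $k\in\omega$. *)

theory Defs
  imports "HOL-Analysis.Analysis"
begin

text \<open>
  Lebesgue measure gives every interval its length, including infinite length for the
  unbounded ones. It is taken in \<^typ>\<open>ennreal\<close> since the real-valued \<^const>\<open>measure\<close>
  would assign length 0 to unbounded intervals. Note that \<^const>\<open>is_interval\<close> admits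
  open, closed, half-open, degenerate and empty intervals.
\<close>

definition picoscopic :: "real set \<Rightarrow> bool" where
  "picoscopic M \<longleftrightarrow>
    (\<forall>\<epsilon>::real. 0 < \<epsilon> \<and> \<epsilon> < 1 \<longrightarrow>
      (\<exists>I :: nat \<Rightarrow> real set.
        (\<forall>k. is_interval (I k)) \<and>
        M \<subseteq> (\<Union>k. I k) \<and>
        (\<forall>k. emeasure lborel (I k) \<le> ennreal (\<epsilon> ^ fact (k + 1)))))"

end

theory Submission
  imports Defs "HOL-Library.Sublist"
begin

text \<open>
  Put \<open>\<epsilon> = 1/32\<close> and call an interval of length at most \<open>\<epsilon> ^ fact (r + 1)\<close> one of class \<open>r\<close>.
  Consider a tree of intervals (cells) such that an interval of class \<open>r\<close> meets at most one cell
  of level \<open>r\<close>, although a cell of level \<open>r\<close> is much shorter than class \<open>r\<close> permits. The set is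
  \<open>X = (\<Inter>m. \<Union>k. C m k)\<close> where \<open>C m k\<close> is a cell of level \<open>max k m\<close>, so that the \<open>m\<close>-th union
  witnesses the covering condition for \<open>\<epsilon> ^ (m + 1)\<close>.

  The cells \<open>C m k\<close>, for fixed \<open>m\<close>, are incomparable, so covering all of them leaves no interval to
  spare. As one interval of a cover of \<open>X \<union> {x}\<close> is wasted on the remote point \<open>x\<close>, each \<open>m\<close> has
  an alive cell \<open>C m k\<close>, that is, one met by no interval of class at most its level. Try to descend
  from an alive cell through alive cells of every family \<open>C m\<close>: success yields a point of \<open>X\<close>
  that is not covered. Otherwise the descent is stuck at some cell \<open>V\<close> with some family \<open>C c\<close>.
  Starting again below an alive \<open>C c k\<close>, it is stuck at some \<open>V'\<close> disjoint from \<open>V\<close>, with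
  some \<open>C d\<close>. But the families are built so that, for any such data, on some long block of indices \<open>k\<close> nearly all \<open>C c k\<close> are spread evenly over \<open>V\<close> and nearly
  all \<open>C d k\<close> over \<open>V'\<close>. Being stuck then takes more than half of the intervals with indices in
  the block to meet \<open>V\<close>, and more than half to meet \<open>V'\<close>.
\<close>

section \<open>Cells\<close>

text \<open>A cell \<open>(i, u)\<close> is the node reached from the \<open>i\<close>-th root along the word \<open>u\<close> of digits below 8.
  The roots are indexed by pairs \<open>(m, k)\<close>, the root of such a pair having level \<open>max m k\<close>.\<close>

type_synonym cell = "nat \<times> nat list"

definition base :: "nat \<Rightarrow> nat" where
  "base i = max (fst (prod_decode i)) (snd (prod_decode i))"

definition lev :: "cell \<Rightarrow> nat" where
  "lev s = base (fst s) + length (snd s)"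

definition words :: "nat \<Rightarrow> nat list set" where
  "words n = {v. set v \<subseteq> {..<8} \<and> length v = n}"

definition cells :: "cell set" where
  "cells = {s. set (snd s) \<subseteq> {..<8}}"

definition anc :: "cell \<Rightarrow> cell \<Rightarrow> bool" where
  "anc s t \<longleftrightarrow> fst s = fst t \<and> prefix (snd s) (snd t)"

definition ext :: "cell \<Rightarrow> nat list \<Rightarrow> cell" where
  "ext s v = (fst s, snd s @ v)"

lemma anc_refl [simp]: "anc s s"
  by (simp add: anc_def)

lemma anc_trans: "anc s t \<Longrightarrow> anc t u \<Longrightarrow> anc s u"
  unfolding anc_def by (metis prefix_order.trans)

lemma anc_linear: "anc s u \<Longrightarrow> anc t u \<Longrightarrow> anc s t \<or> anc t s"
  unfolding anc_def by (metis prefix_same_cases)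

lemma anc_lev: "anc s t \<Longrightarrow> lev s \<le> lev t"
  by (auto simp: anc_def lev_def dest: prefix_length_le)

lemma anc_ext [simp]: "anc s (ext s v)"
  by (simp add: anc_def ext_def)

lemma anc_ext_ext: "anc (ext s u) (ext s v) \<longleftrightarrow> prefix u v"
  by (simp add: anc_def ext_def)

lemma lev_ext: "lev (ext s v) = lev s + length v"
  by (simp add: lev_def ext_def)

lemma anc_imp_ext: "anc s t \<Longrightarrow> t = ext s (drop (length (snd s)) (snd t))"
  by (auto simp: anc_def ext_def prefix_def prod_eq_iff)

lemma ext_in_cells: "s \<in> cells \<Longrightarrow> v \<in> words n \<Longrightarrow> ext s v \<in> cells"
  by (auto simp: cells_def words_def ext_def)

lemma anc_cells: "anc s t \<Longrightarrow> t \<in> cells \<Longrightarrow> s \<in> cells"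
  by (auto simp: cells_def anc_def dest!: set_mono_prefix)

section \<open>Counting words with marked prefixes\<close>

lemma finite_words [simp]: "finite (words n)"
  by (simp add: words_def finite_lists_length_eq)

lemma card_words: "card (words n) = 8 ^ n"
  by (simp add: words_def card_lists_length_eq)

lemma card_words_take:
  assumes "j \<le> n"
  shows "card {v \<in> words n. take j v = z} \<le> 8 ^ (n - j)"
proof -
  have "card {v \<in> words n. take j v = z} \<le> card (words (n - j))"
  proof (rule card_inj_on_le)
    show "inj_on (drop j) {v \<in> words n. take j v = z}"
      by (rule inj_onI) (metis (mono_tags, lifting) append_take_drop_id mem_Collect_eq)
    show "drop j ` {v \<in> words n. take j v = z} \<subseteq> words (n - j)"
      by (auto simp: words_def dest: in_set_dropD)
  qed simp
  then show ?thesis by (simp add: card_words)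
qed

lemma geometric_8: "7 * (\<Sum>j = 1..n. 8 ^ (n - j)) + 1 = (8 ^ n :: nat)"
proof (induction n)
  case (Suc n)
  have "(\<Sum>j = 1..Suc n. 8 ^ (Suc n - j)) = (\<Sum>j = 1..n. 8 * 8 ^ (n - j)) + (1::nat)"
    by (simp add: Suc_diff_le)
  then show ?case using Suc by (simp add: sum_distrib_left [symmetric])
qed simp

text \<open>One marked prefix of length \<open>j\<close> claims at most \<open>8 ^ (n - j)\<close>
  words, and the geometric sum over \<open>j\<close> stays below a seventh of all words.\<close>

lemma card_words_marked:
  "7 * card {v \<in> words n. \<exists>j \<in> {1..n}. take j v = z j} \<le> 8 ^ n"
proof -
  have "{v \<in> words n. \<exists>j \<in> {1..n}. take j v = z j} = (\<Union>j \<in> {1..n}. {v \<in> words n. take j v = z j})"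
    by auto
  also have "card \<dots> \<le> (\<Sum>j \<in> {1..n}. card {v \<in> words n. take j v = z j})"
    by (rule card_UN_le) simp
  also have "\<dots> \<le> (\<Sum>j \<in> {1..n}. 8 ^ (n - j))"
    by (rule sum_mono) (use card_words_take in auto)
  finally show ?thesis using geometric_8 [of n] by linarith
qed

text \<open>A blocking \<open>f k\<close> lies strictly below \<open>V\<close>, so it is not a root
  and \<open>k > m\<close>. Its level is then \<open>k\<close>, which leaves at most one blocker per
  level, that is, one marked prefix per length.\<close>

lemma card_words_blocked:
  fixes f :: "nat \<Rightarrow> cell"
  assumes lev: "\<And>k. k \<in> K \<Longrightarrow> lev (f k) = max k m"
    and root: "\<And>k. k \<in> K \<Longrightarrow> k \<le> m \<Longrightarrow> snd (f k) = []"
    and V: "\<And>k. k \<in> K \<Longrightarrow> \<not> anc (f k) V"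
  shows "7 * card {v \<in> words n. \<exists>k \<in> K. anc (f k) (ext V v)} \<le> 8 ^ n"
proof -
  define z where "z j = drop (length (snd V)) (snd (f (lev V + j)))" for j
  have "{v \<in> words n. \<exists>k \<in> K. anc (f k) (ext V v)} \<subseteq> {v \<in> words n. \<exists>j \<in> {1..n}. take j v = z j}"
  proof safe
    fix v k assume v: "v \<in> words n" and k: "k \<in> K" and a: "anc (f k) (ext V v)"
    have Vf: "anc V (f k)" using anc_linear [OF a anc_ext] V [OF k] by blast
    define y where "y = drop (length (snd V)) (snd (f k))"
    have fk: "f k = ext V y" unfolding y_def by (rule anc_imp_ext [OF Vf])
    have py: "prefix y v" using a fk by (simp add: anc_ext_ext)
    have "y \<noteq> []" using V [OF k] fk by (auto simp: ext_def)
    have "k > m"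
    proof (rule ccontr)
      assume "\<not> m < k"
      then have "snd (f k) = []" using root [OF k] by simp
      then show False using fk \<open>y \<noteq> []\<close> by (simp add: ext_def)
    qed
    then have keq: "k = lev V + length y" using lev [OF k] fk by (simp add: lev_ext)
    have "length y \<le> n" using py v prefix_length_le by (fastforce simp: words_def)
    moreover have "take (length y) v = z (length y)"
      using py unfolding z_def keq [symmetric] y_def [symmetric]
      by (auto simp: prefix_def)
    ultimately show "\<exists>j \<in> {1..n}. take j v = z j"
      using \<open>y \<noteq> []\<close> by (intro bexI [of _ "length y"]) (auto simp: Suc_le_eq)
  qed
  then have "card {v \<in> words n. \<exists>k \<in> K. anc (f k) (ext V v)}
      \<le> card {v \<in> words n. \<exists>j \<in> {1..n}. take j v = z j}"
    by (intro card_mono) auto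
  then show ?thesis using card_words_marked [of n z] by linarith
qed

section \<open>Tight sequences of cells\<close>

text \<open>\<open>W k\<close> is the target proposed for the \<open>k\<close>-th cell. As levels
  never decrease, keeping earlier cells from being above later ones already makes \<open>f\<close>
  an antichain.\<close>

definition tight :: "nat \<Rightarrow> (nat \<Rightarrow> cell) \<Rightarrow> (nat \<Rightarrow> cell) \<Rightarrow> bool" where
  "tight m W f \<longleftrightarrow> (\<forall>k. f k \<in> cells \<and> lev (f k) = max k m \<and> (\<forall>j<k. \<not> anc (f j) (f k)) \<and>
    (k \<le> m \<longrightarrow> f k = (prod_encode (m, k), [])) \<and>
    (k > m \<and> W k \<in> cells \<and> lev (W k) \<le> k \<and> (\<forall>j<k. \<not> anc (f j) (W k)) \<longrightarrow> anc (W k) (f k)))"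

lemma exists_tight: "\<exists>f. tight m W f"
proof -
  let ?Q = "\<lambda>f k s. s \<in> cells \<and> lev s = max k m \<and> (\<forall>j<k. \<not> anc (f j) s) \<and>
    (k \<le> m \<longrightarrow> s = (prod_encode (m, k), [])) \<and>
    (k > m \<and> W k \<in> cells \<and> lev (W k) \<le> k \<and> (\<forall>j<k. \<not> anc (f j) (W k)) \<longrightarrow> anc (W k) s)"
  have "\<exists>f. \<forall>k. ?Q f k (f k)"
  proof (rule dependent_wellorder_choice)
    fix r and f g :: "nat \<Rightarrow> cell" and k
    assume "\<And>y. y < k \<Longrightarrow> f y = g y"
    then show "?Q f k r = ?Q g k r" by simp
  next
    fix k and f :: "nat \<Rightarrow> cell"
    assume IH: "\<And>y. y < k \<Longrightarrow> ?Q f y (f y)"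
    show "\<exists>r. ?Q f k r"
    proof (cases "k > m \<and> W k \<in> cells \<and> lev (W k) \<le> k \<and> (\<forall>j<k. \<not> anc (f j) (W k))")
      case True
      define n where "n = k - lev (W k)"
      \<comment> \<open>Earlier cells block at most a seventh of the descendants of the target at
        level \<open>k\<close>, so a free one remains.\<close>
      have "7 * card {v \<in> words n. \<exists>j \<in> {..<k}. anc (f j) (ext (W k) v)} \<le> 8 ^ n"
        by (rule card_words_blocked [where m = m]) (use IH True in auto)
      moreover have "(8::nat) ^ n > 0" by simp
      ultimately have "card {v \<in> words n. \<exists>j \<in> {..<k}. anc (f j) (ext (W k) v)} \<noteq> card (words n)"
        unfolding card_words by linarith
      then have "{v \<in> words n. \<exists>j \<in> {..<k}. anc (f j) (ext (W k) v)} \<noteq> words n"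
        by metis
      then obtain v where v: "v \<in> words n" "\<forall>j<k. \<not> anc (f j) (ext (W k) v)"
        by blast
      have "lev (ext (W k) v) = k"
        using v(1) True by (simp add: lev_ext words_def n_def)
      then show ?thesis using True v ext_in_cells
        by (intro exI [of _ "ext (W k) v"]) auto
    next
      case False
      \<comment> \<open>Fallback to a fresh root: only a cell equal to that root could be above it,
        and levels and indices exclude this for earlier cells.\<close>
      have "\<not> anc (f j) (prod_encode (m, k), [])" if "j < k" for j
      proof
        assume a: "anc (f j) (prod_encode (m, k), [])"
        then have "lev (f j) = max m k" by (simp add: anc_def lev_def base_def)
        then have "j \<le> m" using IH [OF that] that by auto
        then show False using IH [OF that] a that by (auto simp: anc_def)
      qed
      then show ?thesis using False
        by (intro exI [of _ "(prod_encode (m, k), [])"]) (auto simp: cells_def lev_def base_def)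
    qed
  qed
  then show ?thesis by (simp only: tight_def)
qed

definition aims :: "(nat \<Rightarrow> cell) \<Rightarrow> nat \<Rightarrow> cell \<Rightarrow> bool" where
  "aims f k W \<longleftrightarrow> (\<forall>j<k. \<not> anc (f j) W) \<longrightarrow> anc W (f k)"

text \<open>The \<open>t\<close>-th task occupies the indices from \<open>2 * blk a t\<close> up to \<open>2 * blk a t + 8 ^ blk a t\<close>.\<close>

primrec blk :: "(nat \<Rightarrow> nat) \<Rightarrow> nat \<Rightarrow> nat" where
  "blk a 0 = a 0"
| "blk a (Suc t) = 2 * blk a t + 8 ^ blk a t + a (Suc t)"

lemma blk_ge: "a t \<le> blk a t"
  by (cases t) auto

lemma blk_less: "t < t' \<Longrightarrow> 2 * blk a t + 8 ^ blk a t \<le> blk a t'"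
proof (induction t')
  case (Suc t')
  have "2 * blk a t + 8 ^ blk a t \<le> 2 * blk a t' + 8 ^ blk a t'"
  proof (cases "t = t'")
    case False
    then have "2 * blk a t + 8 ^ blk a t \<le> blk a t'" using Suc by simp
    then show ?thesis by linarith
  qed simp
  then show ?case by (simp add: trans_le_add1)
qed simp

lemma blk_unique:
  assumes "2 * blk a t \<le> k" "k < 2 * blk a t + 8 ^ blk a t"
    and "2 * blk a t' \<le> k" "k < 2 * blk a t' + 8 ^ blk a t'"
  shows "t = t'"
  using blk_less [of t t' a] blk_less [of t' t a] assms by (cases t t' rule: linorder_cases) auto

text \<open>Each task has a block of its own, in which every word of length \<open>D\<close> is the
  target once. Starting at \<open>2 * D\<close> keeps the level of a target, at most
  \<open>lev V + D\<close> or \<open>lev V' + D\<close>, within its index.\<close>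

lemma exists_tight_family:
  "\<exists>C :: nat \<Rightarrow> nat \<Rightarrow> cell. (\<forall>m k. C m k \<in> cells \<and> lev (C m k) = max k m \<and>
      (\<forall>j<k. \<not> anc (C m j) (C m k)) \<and> (k \<le> m \<longrightarrow> snd (C m k) = [])) \<and>
    (\<forall>V V' c d. V \<in> cells \<longrightarrow> V' \<in> cells \<longrightarrow> c \<noteq> d \<longrightarrow>
      (\<exists>D v. lev V + lev V' + c + d < D \<and> bij_betw v {..<8 ^ D} (words D) \<and>
        (\<forall>i<8 ^ D. aims (C c) (2 * D + i) (ext V (v i)) \<and> aims (C d) (2 * D + i) (ext V' (v i)))))"
proof -
  have "\<exists>v. bij_betw v {..<8 ^ D :: nat} (words D)" for D
    using ex_bij_betw_nat_finite [OF finite_words [of D]]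
    by (simp add: card_words atLeast0LessThan)
  then obtain v where v: "\<And>D. bij_betw (v D) {..<8 ^ D :: nat} (words D)" by metis
  define task :: "nat \<Rightarrow> cell \<times> nat \<times> cell \<times> nat" where "task = from_nat"
  define a where "a t = (case task t of (V, c, V', d) \<Rightarrow> Suc (lev V + lev V' + c + d))" for t
  define tm where "tm k = (SOME t. 2 * blk a t \<le> k \<and> k < 2 * blk a t + 8 ^ blk a t)" for k
  \<comment> \<open>One rule serves both families of a task: \<open>c\<close> works on
    \<open>V\<close>, every other family, in particular \<open>d\<close>, on \<open>V'\<close>. This
    is where \<open>c \<noteq> d\<close> enters.\<close>
  define W where "W m k = (case task (tm k) of (V, c, V', d) \<Rightarrow>
    ext (if m = c then V else V') (v (blk a (tm k)) (k - 2 * blk a (tm k))))" for m k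
  obtain C where C: "\<And>m. tight m (W m) (C m)"
    using choice [of "\<lambda>m. tight m (W m)"] exists_tight by blast
  have "\<exists>D v. lev V + lev V' + c + d < D \<and> bij_betw v {..<8 ^ D} (words D) \<and>
        (\<forall>i<8 ^ D. aims (C c) (2 * D + i) (ext V (v i)) \<and> aims (C d) (2 * D + i) (ext V' (v i)))"
    if V: "V \<in> cells" "V' \<in> cells" "c \<noteq> d" for V V' c d
  proof -
    define t where "t = to_nat (V, c, V', d)"
    have t: "task t = (V, c, V', d)" by (simp add: task_def t_def)
    let ?D = "blk a t"
    have D: "lev V + lev V' + c + d < ?D" using blk_ge [of a t] t by (simp add: a_def)
    have "aims (C c) (2 * ?D + i) (ext V (v ?D i)) \<and> aims (C d) (2 * ?D + i) (ext V' (v ?D i))"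
      if i: "i < 8 ^ ?D" for i
    proof -
      let ?k = "2 * ?D + i"
      have "2 * blk a (tm ?k) \<le> ?k \<and> ?k < 2 * blk a (tm ?k) + 8 ^ blk a (tm ?k)"
        unfolding tm_def by (rule someI [where x = t]) (use i in auto)
      then have tm: "tm ?k = t" using blk_unique [of a "tm ?k" ?k t] i by simp
      have W: "W c ?k = ext V (v ?D i)" "W d ?k = ext V' (v ?D i)"
        using V(3) by (auto simp: W_def tm t)
      have vi: "v ?D i \<in> words ?D" using v [of ?D] i by (auto simp: bij_betw_def)
      have "lev (W c ?k) \<le> ?k" "lev (W d ?k) \<le> ?k"
        using vi D by (auto simp: W lev_ext words_def)
      moreover have "W c ?k \<in> cells" "W d ?k \<in> cells"
        using vi V ext_in_cells by (auto simp: W)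
      moreover have "?k > c" "?k > d" using D by auto
      ultimately show ?thesis
        using C [of c] C [of d] unfolding tight_def aims_def W [symmetric] by blast
    qed
    then show ?thesis using v [of ?D] D by (intro exI [of _ ?D] exI [of _ "v ?D"]) auto
  qed
  moreover have "C m k \<in> cells \<and> lev (C m k) = max k m \<and> (\<forall>j<k. \<not> anc (C m j) (C m k)) \<and>
      (k \<le> m \<longrightarrow> snd (C m k) = [])" for m k
    using C [of m] by (simp add: tight_def)
  ultimately show ?thesis by (intro exI [of _ C]) blast
qed

section \<open>Escaping a deficient cover\<close>

locale tight_family =
  fixes C :: "nat \<Rightarrow> nat \<Rightarrow> cell"
  assumes C_cells: "C m k \<in> cells"
    and C_lev: "lev (C m k) = max k m"
    and C_anti: "j < k \<Longrightarrow> \<not> anc (C m j) (C m k)"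
    and C_root: "k \<le> m \<Longrightarrow> snd (C m k) = []"
    and C_task: "V \<in> cells \<Longrightarrow> V' \<in> cells \<Longrightarrow> c \<noteq> d \<Longrightarrow>
      \<exists>D v. lev V + lev V' + c + d < D \<and> bij_betw v {..<8 ^ D} (words D) \<and>
        (\<forall>i<8 ^ D. aims (C c) (2 * D + i) (ext V (v i)) \<and> aims (C d) (2 * D + i) (ext V' (v i)))"

text \<open>\<open>H r s\<close> abstracts that the \<open>r\<close>-th interval of the cover meets
  the cell \<open>s\<close>; \<open>miss\<close> is the index of an interval spent on the extra
  point.\<close>

locale deficient_cover = tight_family +
  fixes H :: "nat \<Rightarrow> cell \<Rightarrow> bool" and miss :: nat
  assumes H_anc: "H r t \<Longrightarrow> anc s t \<Longrightarrow> H r s"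
    and H_root: "H r s \<Longrightarrow> H r t \<Longrightarrow> fst s = fst t"
    and H_sep: "H r s \<Longrightarrow> H r t \<Longrightarrow> lev s \<le> r \<Longrightarrow> lev s \<le> lev t \<Longrightarrow> anc s t"
    and H_miss: "\<not> H miss s"
begin

definition alive :: "cell \<Rightarrow> bool" where
  "alive s \<longleftrightarrow> (\<forall>r \<le> lev s. \<not> H r s)"

text \<open>If \<open>C m j\<close> is a root, sharing the root already puts it above
  \<open>C m k\<close>; otherwise \<open>r = j\<close> is its level and \<open>H_sep\<close> does
  so. Either way the antichain property fails.\<close>

lemma H_unique:
  assumes "H r (C m k)" "H r (C m j)" "j < k" "r \<le> m \<and> j \<le> m \<or> r = j"
  shows False
proof (cases "j \<le> m")
  case True
  have "fst (C m j) = fst (C m k)" using H_root assms by blast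
  then have "anc (C m j) (C m k)" using C_root [OF True] by (simp add: anc_def)
  then show ?thesis using C_anti assms by blast
next
  case False
  then have "anc (C m j) (C m k)"
    using assms by (intro H_sep [of r]) (auto simp: C_lev)
  then show ?thesis using C_anti assms by blast
qed

text \<open>Without an alive cell, the cover would have to spend its \<open>k\<close>-th interval on the \<open>k\<close>-th cell,
  for every \<open>k\<close> beyond the initial block, leaving nothing to miss.\<close>

lemma exists_alive: "\<exists>k. alive (C m k)"
proof (rule ccontr)
  assume "\<nexists>k. alive (C m k)"
  then have "\<forall>k. \<exists>r. r \<le> max k m \<and> H r (C m k)" unfolding alive_def C_lev by blast
  then obtain \<rho> where \<rho>: "\<And>k. \<rho> k \<le> max k m" "\<And>k. H (\<rho> k) (C m k)" by metis
  have le: "\<rho> k \<le> m" if "k \<le> m" for k using \<rho>(1) [of k] that by simp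
  \<comment> \<open>Pigeonhole: the first \<open>m + 1\<close> cells use up all intervals with index
    at most \<open>m\<close>.\<close>
  have "inj_on \<rho> {..m}"
  proof (rule linorder_inj_onI')
    fix i j assume "i \<in> {..m}" "j \<in> {..m}" "i < j"
    then show "\<rho> i \<noteq> \<rho> j"
      using H_unique [of "\<rho> j" m j i] \<rho>(2) [of i] \<rho>(2) [of j] le [of j] by (metis atMost_iff)
  qed
  then have surj: "\<rho> ` {..m} = {..m}"
    by (intro endo_inj_surj) (use le in auto)
  \<comment> \<open>By induction all smaller indices are already taken by earlier cells.\<close>
  have id: "\<rho> k = k" if "k > m" for k
    using that
  proof (induction k rule: less_induct)
    case (less k)
    show ?case
    proof (rule ccontr)
      assume "\<rho> k \<noteq> k"
      then have lt: "\<rho> k < k" using \<rho>(1) [of k] less.prems by auto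
      show False
      proof (cases "\<rho> k \<le> m")
        case True
        then obtain j where "j \<le> m" "\<rho> j = \<rho> k"
          using surj True by (metis atMost_iff imageE)
        then show False
          using H_unique [of "\<rho> k" m k j] \<rho>(2) [of j] \<rho>(2) [of k] True less.prems
          by (metis le_less_trans)
      next
        case False
        then have "\<rho> (\<rho> k) = \<rho> k" using less.IH [OF lt] by simp
        then show False
          using H_unique [of "\<rho> k" m k "\<rho> k"] \<rho>(2) [of "\<rho> k"] \<rho>(2) [of k] lt by metis
      qed
    qed
  qed
  show False
  proof (cases "miss \<le> m")
    case True
    then obtain k where "\<rho> k = miss" using surj True by (metis atMost_iff imageE)
    then show ?thesis using \<rho>(2) [of k] H_miss by simp
  next
    case False
    then show ?thesis using id [of miss] \<rho>(2) [of miss] H_miss by simp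
  qed
qed

definition stuck :: "cell \<Rightarrow> nat \<Rightarrow> bool" where
  "stuck V c \<longleftrightarrow> V \<in> cells \<and> alive V \<and> (\<forall>k. \<not> anc (C c k) V) \<and> (\<forall>k. alive (C c k) \<longrightarrow> \<not> anc V (C c k))"

text \<open>Discard the words blocked by the family (\<open>B1\<close>) and those met by an interval
  of index at most \<open>lev V + D\<close> (\<open>B2\<close>), a seventh each. Below every other
  word the family has a cell that is not alive, and by \<open>H_sep\<close> the intervals hitting
  these cells have distinct indices.\<close>

lemma stuck_hits:
  assumes st: "stuck V c" and v: "bij_betw v {..<8 ^ D} (words D)"
    and aim: "\<And>i. i < 8 ^ D \<Longrightarrow> aims (C c) (2 * D + i) (ext V (v i))"
    and mD: "c \<le> D"
  shows "5 * 8 ^ D \<le> 7 * card {r. lev V + D < r \<and> r < 2 * D + 8 ^ D \<and> H r V}"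
    (is "_ \<le> 7 * card ?R")
proof -
  have V: "\<And>k. \<not> anc (C c k) V" "\<And>k. alive (C c k) \<Longrightarrow> \<not> anc V (C c k)"
    and live: "\<And>r. H r V \<Longrightarrow> lev V < r"
    using st unfolding stuck_def alive_def by (blast, blast, meson not_le_imp_less)
  define B1 where "B1 = {w \<in> words D. \<exists>k \<in> UNIV. anc (C c k) (ext V w)}"
  \<comment> \<open>By \<open>H_sep\<close> the interval of index \<open>lev V + j\<close> meets at
    most one subcell of \<open>V\<close> at level \<open>lev V + j\<close>, so any choice of word
    yields the same prefix. If there is none, the arbitrary value can only enlarge
    \<open>B2\<close>.\<close>
  define z where "z j = take j (SOME w. w \<in> words D \<and> H (lev V + j) (ext V w))" for j
  define B2 where "B2 = {w \<in> words D. \<exists>j \<in> {1..D}. take j w = z j}"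
  have card_B1: "7 * card B1 \<le> 8 ^ D"
    unfolding B1_def by (rule card_words_blocked [where m = c]) (use V C_lev C_root in auto)
  have card_B2: "7 * card B2 \<le> 8 ^ D"
    unfolding B2_def by (rule card_words_marked)
  have B2I: "w \<in> B2" if w: "w \<in> words D" and H: "H r (ext V w)" and r: "r \<le> lev V + D" for w r
  proof -
    have "lev V < r" using live H_anc [OF H anc_ext] by blast
    then obtain j where j: "r = lev V + j" "j \<in> {1..D}"
      using r by (intro that [of "r - lev V"]) auto
    define w' where "w' = (SOME w. w \<in> words D \<and> H (lev V + j) (ext V w))"
    have w': "w' \<in> words D \<and> H (lev V + j) (ext V w')"
      unfolding w'_def by (rule someI [where x = w]) (use w H j in auto)
    have "anc (ext V (take j w)) (ext V w)" by (simp add: anc_ext_ext take_is_prefix)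
    then have "H r (ext V (take j w))" using H_anc H by blast
    then have "anc (ext V (take j w)) (ext V w')"
      using w w' j by (intro H_sep [of r]) (auto simp: lev_ext words_def)
    then have "take j w = take j w'"
      using w j by (auto simp: anc_ext_ext prefix_def words_def)
    then show ?thesis using w j(2) unfolding B2_def z_def w'_def by auto
  qed
  have "\<exists>r \<in> ?R. H r (ext V w)" if w: "w \<in> words D - B1 - B2" for w
  proof -
    obtain i where i: "i < 8 ^ D" "v i = w"
      using v w by (metis DiffD1 bij_betw_imp_surj_on imageE lessThan_iff)
    let ?k = "2 * D + i"
    have "anc (ext V w) (C c ?k)"
      using aim [OF i(1)] w i(2) by (auto simp: aims_def B1_def)
    then have "\<not> alive (C c ?k)" using V(2) anc_trans [OF anc_ext] by blast
    then obtain r where r: "r \<le> ?k" "H r (C c ?k)" using mD by (auto simp: alive_def C_lev)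
    then have H: "H r (ext V w)" using H_anc \<open>anc (ext V w) (C c ?k)\<close> by blast
    moreover have "H r V" using H H_anc anc_ext by blast
    moreover have "lev V + D < r" using B2I [OF _ H] w by force
    ultimately show ?thesis using r(1) i(1) by auto
  qed
  then obtain \<rho> where \<rho>: "\<And>w. w \<in> words D - B1 - B2 \<Longrightarrow> \<rho> w \<in> ?R \<and> H (\<rho> w) (ext V w)"
    by metis
  have "inj_on \<rho> (words D - B1 - B2)"
  proof (rule inj_onI)
    fix w w' assume w: "w \<in> words D - B1 - B2" "w' \<in> words D - B1 - B2" "\<rho> w = \<rho> w'"
    have len: "length w = D" "length w' = D" using w by (auto simp: words_def)
    have "H (\<rho> w) (ext V w)" "H (\<rho> w) (ext V w')" "lev V + D < \<rho> w" using \<rho> w by force+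
    then have "anc (ext V w) (ext V w')"
      using len by (intro H_sep [of "\<rho> w"]) (auto simp: lev_ext)
    then show "w = w'" using len by (auto simp: anc_ext_ext prefix_def)
  qed
  then have "card (words D - B1 - B2) \<le> card ?R"
    by (rule card_inj_on_le) (use \<rho> in auto)
  moreover have "card (words D) \<le> card ((words D - B1 - B2) \<union> (B1 \<union> B2))"
    by (rule card_mono) (auto simp: B1_def B2_def)
  moreover have "\<dots> \<le> card (words D - B1 - B2) + (card B1 + card B2)"
    by (meson add_left_mono card_Un_le le_trans)
  ultimately show ?thesis using card_B1 card_B2 unfolding card_words by linarith
qed

text \<open>An interval meeting both would make \<open>V\<close> and \<open>V'\<close> comparable,
  hence also \<open>V\<close> and the alive \<open>C c k\<close>, which stuckness forbids.\<close>

lemma stuck_hits_disjoint: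
  assumes V: "stuck V c" and V': "stuck V' d" and k: "alive (C c k)" "anc (C c k) V'"
    and H: "H r V" "H r V'" "lev V \<le> r" "lev V' \<le> r"
  shows False
proof -
  have "anc V V' \<or> anc V' V"
    using H_sep [of r V V'] H_sep [of r V' V] H by (metis nle_le)
  moreover have "\<not> anc V' V" using V k(2) unfolding stuck_def by (meson anc_trans)
  ultimately have "anc V (C c k) \<or> anc (C c k) V" using anc_linear k(2) by blast
  then show False using V k(1) by (auto simp: stuck_def)
qed

text \<open>Such a chain shrinks to a point that lies in every union of the families and in no
  interval of the cover.\<close>

definition escapes :: "(nat \<Rightarrow> cell) \<Rightarrow> bool" where
  "escapes V \<longleftrightarrow> (\<forall>n. V n \<in> cells) \<and> (\<forall>n. anc (V n) (V (Suc n))) \<and>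
    (\<forall>m. \<exists>k n. anc (C m k) (V n)) \<and> (\<forall>r. \<exists>n. \<not> H r (V n))"

lemma stuck_or_escapes:
  assumes V0: "V0 \<in> cells" "alive V0"
  shows "(\<exists>V c. anc V0 V \<and> stuck V c) \<or> (\<exists>V. escapes V)"
proof (rule disjCI)
  assume no: "\<nexists>V. escapes V"
  show "\<exists>V c. anc V0 V \<and> stuck V c"
  proof (rule ccontr)
    assume ns: "\<nexists>V c. anc V0 V \<and> stuck V c"
    let ?P = "\<lambda>V. V \<in> cells \<and> alive V \<and> anc V0 V"
    let ?Q = "\<lambda>n V V'. anc V V' \<and> (\<exists>k. anc (C n k) V')"
    have "\<exists>f. \<forall>n. ?P (f n) \<and> ?Q n (f n) (f (Suc n))"
    proof (rule dependent_nat_choice)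
      show "\<exists>V. ?P V" using V0 by (intro exI [of _ V0]) simp
    next
      fix V n assume V: "?P V"
      show "\<exists>V'. ?P V' \<and> ?Q n V V'"
      proof (cases "\<exists>k. anc (C n k) V")
        case True
        then show ?thesis using V anc_refl by blast
      next
        case False
        then obtain k where "alive (C n k)" "anc V (C n k)"
          using ns V unfolding stuck_def by blast
        then show ?thesis
          using V C_cells [of n k] anc_trans [of V0 V "C n k"]
          by (intro exI [of _ "C n k"]) (use anc_refl in blast)
      qed
    qed
    then obtain f where f: "\<And>n. ?P (f n)" "\<And>n. ?Q n (f n) (f (Suc n))" by metis
    \<comment> \<open>Having entered family \<open>r\<close>, the chain has level at least
      \<open>r\<close>, so being alive rules out the \<open>r\<close>-th interval.\<close>
    have "\<not> H r (f (Suc r))" for r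
    proof -
      obtain k where "anc (C r k) (f (Suc r))" using f(2) by blast
      then have "r \<le> lev (f (Suc r))" using anc_lev [of "C r k"] by (fastforce simp: C_lev)
      then show ?thesis using f(1) by (auto simp: alive_def)
    qed
    then have "escapes f" using f unfolding escapes_def by blast
    then show False using no by blast
  qed
qed

lemma exists_escape: "\<exists>V. escapes V"
proof (rule ccontr)
  assume no: "\<nexists>V. escapes V"
  obtain k0 where "alive (C 0 k0)" using exists_alive by blast
  then obtain V c where V: "stuck V c" using stuck_or_escapes C_cells no by blast
  obtain k where k: "alive (C c k)" using exists_alive by blast
  then obtain V' d where V': "stuck V' d" "anc (C c k) V'" using stuck_or_escapes C_cells no by blast
  then have "c \<noteq> d" by (auto simp: stuck_def)
  then obtain D v where D: "lev V + lev V' + c + d < D" "bij_betw v {..<8 ^ D} (words D)"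
    "\<And>i. i < 8 ^ D \<Longrightarrow> aims (C c) (2 * D + i) (ext V (v i))"
    "\<And>i. i < 8 ^ D \<Longrightarrow> aims (C d) (2 * D + i) (ext V' (v i))"
    using C_task [of V V' c d] V V' by (auto simp: stuck_def)
  let ?R = "\<lambda>V. {r. lev V + D < r \<and> r < 2 * D + 8 ^ D \<and> H r V}"
  have "5 * 8 ^ D \<le> 7 * card (?R V)" "5 * 8 ^ D \<le> 7 * card (?R V')"
    by (rule stuck_hits [OF V D(2,3)] stuck_hits [OF V'(1) D(2,4)]; use D(1) in simp)+
  \<comment> \<open>Both sets lie in a window of \<open>D + 8 ^ D\<close> indices, too short for two
    disjoint sets of size at least five sevenths of \<open>8 ^ D\<close>.\<close>
  moreover have "card (?R V) + card (?R V') \<le> D + 8 ^ D"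
  proof -
    have "?R V \<inter> ?R V' = {}"
      using stuck_hits_disjoint [OF V V'(1) k V'(2)] D(1) by fastforce
    then have "card (?R V) + card (?R V') = card (?R V \<union> ?R V')"
      by (intro card_Un_disjoint [symmetric]) auto
    also have "\<dots> \<le> card {D..<2 * D + 8 ^ D}"
      by (intro card_mono) auto
    finally show ?thesis by simp
  qed
  ultimately have "3 * 8 ^ D \<le> 7 * D" by linarith
  moreover have "7 * D < 3 * 8 ^ D" by (induction D) auto
  ultimately show False by linarith
qed

end

section \<open>Realising cells as intervals\<close>

definition tiny :: "nat \<Rightarrow> real" where
  "tiny r = (1 / 32) ^ fact (r + 1)"

text \<open>The extra exponent \<open>r + 1\<close> lets one family serve every \<epsilon> above
  \<open>(1 / 32) ^ m\<close>.\<close>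

definition len :: "nat \<Rightarrow> real" where
  "len r = tiny r ^ (r + 1)"

lemma tiny_pos [simp]: "0 < tiny r"
  by (simp add: tiny_def)

lemma len_pos [simp]: "0 < len r"
  by (simp add: len_def)

lemma tiny_antimono: "r \<le> s \<Longrightarrow> tiny s \<le> tiny r"
  unfolding tiny_def by (intro power_decreasing fact_mono) auto

lemma tiny_le: "tiny r \<le> 1 / 32"
  using tiny_antimono [of 0 r] by (simp add: tiny_def)

lemma len_le_tiny: "len r \<le> tiny r"
  unfolding len_def using tiny_le [of r] power_decreasing [of 1 "r + 1" "tiny r"]
  by (simp add: less_imp_le)

text \<open>The factorial exponent grows by the factor \<open>r + 2\<close>, so the next class is
  shorter than a cell of level \<open>r\<close>, by the factor \<open>tiny r\<close>. This leaves
  room for eight subcells with gaps.\<close>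

lemma tiny_Suc: "tiny (Suc r) = tiny r * len r"
proof -
  have "fact (Suc r + 1) = fact (r + 1) * (r + 2)" by simp
  then have "tiny (Suc r) = tiny r ^ (r + 2)" unfolding tiny_def by (metis power_mult)
  then show ?thesis by (simp add: len_def)
qed

lemma len_ge_gaps: "24 * tiny (Suc r) \<le> len r"
  using mult_right_mono [OF tiny_le [of r], of "len r"] len_pos [of r]
  unfolding tiny_Suc by linarith

text \<open>Consecutive subcells at level \<open>r\<close> are placed at distance \<open>3 * tiny r\<close>, so that the gaps
  between them exceed \<open>tiny r\<close> while eight of them fit into a cell at level \<open>r - 1\<close>.\<close>

primrec offset :: "nat \<Rightarrow> nat list \<Rightarrow> real" where
  "offset b [] = 0"
| "offset b (d # u) = d * (3 * tiny (Suc b)) + offset (Suc b) u"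

text \<open>Roots start at even integers, so that no interval of any class meets two of
  them.\<close>

definition seg :: "cell \<Rightarrow> real set" where
  "seg s = (let a = 2 * real (fst s) + offset (base (fst s)) (snd s) in {a..a + len (lev s)})"

lemma offset_append: "offset b (u @ v) = offset b u + offset (b + length u) v"
  by (induction u arbitrary: b) auto

lemma offset_bounds:
  "set u \<subseteq> {..<8} \<Longrightarrow> 0 \<le> offset b u \<and> offset b u + len (b + length u) \<le> len b"
proof (induction u arbitrary: b)
  case (Cons d u)
  have IH: "0 \<le> offset (Suc b) u" "offset (Suc b) u + len (Suc b + length u) \<le> len (Suc b)"
    using Cons.IH [of "Suc b"] Cons.prems by auto
  have "real d \<le> 7" using Cons.prems by auto
  then have "real d * (3 * tiny (Suc b)) \<le> 7 * (3 * tiny (Suc b))"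
    by (intro mult_right_mono) (auto simp: less_imp_le)
  moreover have "0 \<le> real d * (3 * tiny (Suc b))" by (simp add: less_imp_le)
  ultimately have "0 \<le> real d * (3 * tiny (Suc b)) + offset (Suc b) u"
    "real d * (3 * tiny (Suc b)) + offset (Suc b) u + len (Suc b + length u) \<le> len b"
    using IH len_ge_gaps [of b] len_le_tiny [of "Suc b"] by linarith+
  then show ?case by simp
qed simp

text \<open>At the first differing digit the subcells start at least three units of
  \<open>tiny\<close> apart and each is at most one unit long. Common digits only shift both points
  equally.\<close>

lemma offset_separated:
  assumes "set u \<subseteq> {..<8}" "set u' \<subseteq> {..<8}" "n \<le> length u" "n \<le> length u'"
    and "take n u \<noteq> take n u'"
    and "offset b u \<le> p" "p \<le> offset b u + len (b + length u)"
    and "offset b u' \<le> q" "q \<le> offset b u' + len (b + length u')"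
  shows "tiny (b + n) < \<bar>p - q\<bar>"
  using assms
proof (induction n arbitrary: b u u' p q)
  case (Suc n)
  then obtain d w d' w' where u: "u = d # w" "u' = d' # w'"
    unfolding Suc_le_length_iff by blast
  have w: "set w \<subseteq> {..<8}" "set w' \<subseteq> {..<8}" using Suc.prems u by auto
  let ?g = "3 * tiny (Suc b)"
  show ?case
  proof (cases "d = d'")
    case True
    have "tiny (Suc b + n) < \<bar>(p - d * ?g) - (q - d * ?g)\<bar>"
      by (rule Suc.IH [where u = w and u' = w']) (use Suc.prems u w True in auto)
    then show ?thesis by simp
  next
    case False
    have p: "d * ?g \<le> p" "p \<le> d * ?g + tiny (Suc b)"
      and q: "d' * ?g \<le> q" "q \<le> d' * ?g + tiny (Suc b)"
      using Suc.prems(6-9) offset_bounds [OF w(1), of "Suc b"] offset_bounds [OF w(2), of "Suc b"]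
        len_le_tiny [of "Suc b"] by (auto simp: u)
    have step: "real i * ?g + ?g \<le> real j * ?g" if "i < j" for i j :: nat
    proof -
      have "real (Suc i) * ?g \<le> real j * ?g"
        using that by (intro mult_right_mono) (auto simp: less_imp_le)
      then show ?thesis by (simp add: algebra_simps)
    qed
    have "2 * tiny (Suc b) \<le> \<bar>p - q\<bar>"
    proof (cases "d < d'")
      case True
      then show ?thesis using step [OF True] p q by linarith
    next
      case False
      then have "d' < d" using \<open>d \<noteq> d'\<close> by simp
      then show ?thesis using step [of d' d] p q by linarith
    qed
    moreover have "tiny (b + Suc n) \<le> tiny (Suc b)" by (rule tiny_antimono) simp
    ultimately show ?thesis using tiny_pos [of "Suc b"] by linarith
  qed
qed simp

lemma seg_bounds:
  assumes "s \<in> cells" "p \<in> seg s"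
  shows "2 * real (fst s) \<le> p" "p \<le> 2 * real (fst s) + 1 / 32"
  using assms offset_bounds [of "snd s" "base (fst s)"] len_le_tiny [of "base (fst s)"]
    tiny_le [of "base (fst s)"]
  by (auto simp: seg_def cells_def lev_def Let_def)

lemma seg_mono:
  assumes "anc s t" "t \<in> cells"
  shows "seg t \<subseteq> seg s"
proof -
  obtain v where t: "t = ext s v" using anc_imp_ext [OF assms(1)] by blast
  then have "set v \<subseteq> {..<8}" using assms(2) by (auto simp: cells_def ext_def)
  then have "0 \<le> offset (lev s) v" "offset (lev s) v + len (lev s + length v) \<le> len (lev s)"
    using offset_bounds by auto
  then show ?thesis
    unfolding t seg_def Let_def lev_ext by (simp add: ext_def offset_append lev_def)
qed

lemma seg_close_root:
  assumes "s \<in> cells" "t \<in> cells" "p \<in> seg s" "q \<in> seg t" "\<bar>p - q\<bar> \<le> tiny r"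
  shows "fst s = fst t"
proof (rule ccontr)
  assume "fst s \<noteq> fst t"
  then have "Suc (fst s) \<le> fst t \<or> Suc (fst t) \<le> fst s" by auto
  then have "real (fst s) + 1 \<le> real (fst t) \<or> real (fst t) + 1 \<le> real (fst s)"
    by (metis of_nat_Suc of_nat_le_iff add.commute)
  then show False
    using seg_bounds [OF assms(1,3)] seg_bounds [OF assms(2,4)] assms(5) tiny_le [of r] by linarith
qed

lemma seg_close_anc:
  assumes "s \<in> cells" "t \<in> cells" "p \<in> seg s" "q \<in> seg t" "\<bar>p - q\<bar> \<le> tiny r"
    and "lev s \<le> r" "lev s \<le> lev t"
  shows "anc s t"
proof (rule ccontr)
  assume "\<not> anc s t"
  have root: "fst s = fst t" by (rule seg_close_root [OF assms(1-5)])
  have ln: "length (snd s) \<le> length (snd t)" using assms(7) root by (simp add: lev_def)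
  have ne: "snd s \<noteq> take (length (snd s)) (snd t)"
    using \<open>\<not> anc s t\<close> root by (metis anc_def take_is_prefix)
  have "tiny (base (fst s) + length (snd s)) < \<bar>(p - 2 * fst s) - (q - 2 * fst s)\<bar>"
  proof (rule offset_separated)
    show "set (snd s) \<subseteq> {..<8}" "set (snd t) \<subseteq> {..<8}"
      using assms(1,2) by (simp_all add: cells_def)
    show "take (length (snd s)) (snd s) \<noteq> take (length (snd s)) (snd t)" using ne by simp
    show "offset (base (fst s)) (snd s) \<le> p - 2 * fst s"
      "p - 2 * fst s \<le> offset (base (fst s)) (snd s) + len (base (fst s) + length (snd s))"
      using assms(3) by (simp_all add: seg_def Let_def lev_def)
    show "offset (base (fst s)) (snd t) \<le> q - 2 * fst s"
      "q - 2 * fst s \<le> offset (base (fst s)) (snd t) + len (base (fst s) + length (snd t))"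
      using assms(4) unfolding root by (simp_all add: seg_def Let_def lev_def)
  qed (use ln in simp_all)
  then have "tiny (lev s) < \<bar>p - q\<bar>" by (simp add: lev_def)
  then show False using assms(5) tiny_antimono [OF assms(6)] by linarith
qed

lemma interval_diam:
  fixes J :: "real set"
  assumes "is_interval J" "emeasure lborel J \<le> ennreal e" "0 \<le> e" "p \<in> J" "q \<in> J"
  shows "\<bar>p - q\<bar> \<le> e"
proof -
  have *: "y - x \<le> e" if xy: "x \<in> J" "y \<in> J" "x \<le> y" for x y
  proof -
    have "{x..y} \<subseteq> J"
    proof
      fix z assume "z \<in> {x..y}"
      then show "z \<in> J" using mem_is_interval_1_I [OF assms(1) xy(1,2)] by simp
    qed
    then have "emeasure lborel {x..y} \<le> emeasure lborel J"
      by (rule emeasure_mono) (simp add: real_interval_borel_measurable [OF assms(1)])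
    also note assms(2)
    finally have "ennreal (y - x) \<le> ennreal e" using xy(3) by simp
    then show ?thesis using assms(3) by (simp only: ennreal_le_iff)
  qed
  show ?thesis
  proof (cases "p \<le> q")
    case True
    then show ?thesis using * [OF assms(4,5)] by simp
  next
    case False
    then show ?thesis using * [OF assms(5,4)] by simp
  qed
qed

section \<open>The fractal and the effect of one more point\<close>

context tight_family
begin

definition fractal :: "real set" where
  "fractal = (\<Inter>m. \<Union>k. seg (C m k))"

lemma picoscopic_fractal: "picoscopic fractal"
  unfolding picoscopic_def
proof (intro allI impI)
  fix \<epsilon> :: real assume \<epsilon>: "0 < \<epsilon> \<and> \<epsilon> < 1"
  obtain m where m: "(1 / 32) ^ m < \<epsilon>" using real_arch_pow_inv [of \<epsilon> "1 / 32"] \<epsilon> by auto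
  have "len (max k m) \<le> \<epsilon> ^ fact (k + 1)" for k
  proof -
    have "fact (k + 1) * m \<le> fact (max k m + 1) * (max k m + 1)"
      by (rule mult_le_mono, rule fact_mono) auto
    then have "m * fact (k + 1) \<le> fact (max k m + 1) * (max k m + 1)"
      by (simp only: mult.commute)
    then have "len (max k m) \<le> (1 / 32) ^ (m * fact (k + 1))"
      unfolding len_def tiny_def power_mult [symmetric] by (intro power_decreasing) auto
    also have "\<dots> = ((1 / 32) ^ m) ^ fact (k + 1)" by (rule power_mult)
    also have "\<dots> \<le> \<epsilon> ^ fact (k + 1)" using m by (intro power_mono) auto
    finally show ?thesis .
  qed
  then have "emeasure lborel (seg (C m k)) \<le> ennreal (\<epsilon> ^ fact (k + 1))" for k
    using len_pos [of "max k m"] unfolding seg_def Let_def C_lev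
    by (subst emeasure_lborel_Icc)
      (simp_all only: ennreal_leI add_diff_cancel_left' le_add_same_cancel1 less_imp_le)
  moreover have "is_interval (seg (C m k))" for k
    by (simp add: seg_def Let_def is_interval_cc)
  ultimately show "\<exists>I. (\<forall>k. is_interval (I k)) \<and> fractal \<subseteq> (\<Union>k. I k) \<and>
      (\<forall>k. emeasure lborel (I k) \<le> ennreal (\<epsilon> ^ fact (k + 1)))"
    by (intro exI [of _ "\<lambda>k. seg (C m k)"]) (auto simp: fractal_def)
qed

text \<open>All cells lie in the nonnegative reals, so an interval of any class containing -2 meets
  none of them and provides \<open>miss\<close>.\<close>

lemma not_picoscopic_insert: "\<not> picoscopic (fractal \<union> {-2})"
proof
  assume "picoscopic (fractal \<union> {-2})"
  from this [unfolded picoscopic_def, THEN spec, of "1 / 32"]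
  have "\<exists>I. (\<forall>k. is_interval (I k)) \<and> fractal \<union> {-2} \<subseteq> (\<Union>k. I k) \<and>
      (\<forall>k. emeasure lborel (I k) \<le> ennreal ((1 / 32) ^ fact (k + 1)))"
    by (rule mp) simp
  then obtain I where I: "\<And>k. is_interval (I k)" "fractal \<union> {-2} \<subseteq> (\<Union>k. I k)"
    "\<And>k. emeasure lborel (I k) \<le> ennreal (tiny k)"
    unfolding tiny_def by blast
  have diam: "\<bar>p - q\<bar> \<le> tiny k" if "p \<in> I k" "q \<in> I k" for p q k
    by (rule interval_diam [OF I(1,3) _ that]) (simp add: less_imp_le)
  obtain miss where miss: "-2 \<in> I miss" using I(2) by auto
  define H where "H r s \<longleftrightarrow> s \<in> cells \<and> seg s \<inter> I r \<noteq> {}" for r s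
  interpret deficient_cover C H miss
  proof
    fix r s t assume "H r t" "anc s t"
    then show "H r s" using seg_mono [of s t] anc_cells [of s t] unfolding H_def by blast
  next
    fix r s t assume "H r s" "H r t"
    then obtain p q where "p \<in> seg s" "p \<in> I r" "q \<in> seg t" "q \<in> I r" "s \<in> cells" "t \<in> cells"
      unfolding H_def by blast
    then show "fst s = fst t" by (intro seg_close_root [OF _ _ _ _ diam])
  next
    fix r s t assume "H r s" "H r t" and lev: "lev s \<le> r" "lev s \<le> lev t"
    then obtain p q where "p \<in> seg s" "p \<in> I r" "q \<in> seg t" "q \<in> I r" "s \<in> cells" "t \<in> cells"
      unfolding H_def by blast
    then show "anc s t" by (intro seg_close_anc [OF _ _ _ _ diam lev])
  next
    fix s
    show "\<not> H miss s"
    proof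
      assume "H miss s"
      then obtain p where p: "s \<in> cells" "p \<in> seg s" "p \<in> I miss" by (auto simp: H_def)
      then have "0 \<le> p" using seg_bounds(1) [of s p] by linarith
      then show False
        using diam [OF miss p(3)] tiny_le [of miss] by linarith
    qed
  qed
  obtain V where V: "\<And>n. V n \<in> cells" "\<And>n. anc (V n) (V (Suc n))"
    "\<And>m. \<exists>k n. anc (C m k) (V n)" "\<And>r. \<exists>n. \<not> H r (V n)"
    using exists_escape unfolding escapes_def by blast
  \<comment> \<open>Compactness turns the escaping chain into an actual point of the fractal; the
    interval covering it would meet every cell of the chain.\<close>
  have "(\<Inter>n. seg (V n)) \<noteq> {}"
  proof (rule compact_nest)
    show "compact (seg (V n))" "seg (V n) \<noteq> {}" for n
      using len_pos [of "lev (V n)"] by (auto simp: seg_def Let_def less_imp_le)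
    show "seg (V n) \<subseteq> seg (V m)" if "m \<le> n" for m n
      by (rule lift_Suc_antimono_le [of "\<lambda>n. seg (V n)", OF seg_mono [OF V(2,1)] that])
  qed
  then obtain p where p: "\<And>n. p \<in> seg (V n)" by blast
  have "p \<in> fractal"
    unfolding fractal_def
  proof
    fix m
    obtain k n where "anc (C m k) (V n)" using V(3) by blast
    then show "p \<in> (\<Union>k. seg (C m k))" using seg_mono [OF _ V(1)] p by blast
  qed
  then obtain r where "p \<in> I r" using I(2) by blast
  then have "H r (V n)" for n using p V(1) unfolding H_def by blast
  then show False using V(4) by blast
qed

end

theorem theorem4p3:
  "\<exists>(X :: real set) (x :: real). picoscopic X \<and> \<not> picoscopic (X \<union> {x})"
proof -
  obtain C :: "nat \<Rightarrow> nat \<Rightarrow> cell" where C: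
    "\<And>m k. C m k \<in> cells \<and> lev (C m k) = max k m \<and> (\<forall>j<k. \<not> anc (C m j) (C m k)) \<and>
      (k \<le> m \<longrightarrow> snd (C m k) = [])"
    "\<And>V V' c d. V \<in> cells \<Longrightarrow> V' \<in> cells \<Longrightarrow> c \<noteq> d \<Longrightarrow>
      \<exists>D v. lev V + lev V' + c + d < D \<and> bij_betw v {..<8 ^ D} (words D) \<and>
        (\<forall>i<8 ^ D. aims (C c) (2 * D + i) (ext V (v i)) \<and> aims (C d) (2 * D + i) (ext V' (v i)))"
    using exists_tight_family by metis
  interpret tight_family C
    by unfold_locales ((rule C(2); assumption) | simp add: C(1))+
  show ?thesis
    using picoscopic_fractal not_picoscopic_insert by (intro exI conjI)
qed

end
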